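(* Let $M\ge 1$ and $b\ge 1$ be integers and let $\mu_P,\mu_{Nc},\mu_{Ns}>0$. Suppose that $\lambda>0$ and positive reals $\alpha_{Pc}$, $\alpha_{Nc}$, $\alpha^-_{Ps_i}$ ($1\le i\le b-1$), $\alpha^+_{Ns_i}$ ($1\le i\le b$), $\rho_P,\rho_{Nc},\rho_{Ns}$ satisfy the traffic equations of the fully sharded blockchain with single-destination transactions: $$\alpha_{Pc}=\rho_{Nc}\,\mu_{Nc},\qquad \alpha^-_{Ps_i}=\alpha^+_{Ns_{i+1}}\ (1\le i\le b-1),$$ $$\alpha_{Nc}=\lambda+(M-1)\,\rho_{Ns}\,\mu_{Ns}\cdot\frac1M\cdot\frac{\lambda}{\alpha_{Nc}},\qquad \alpha^+_{Ns_b}=\rho_P\,\mu_P,\qquad \alpha^+_{Ns_i}=\rho_P\,\alpha^-_{Ps_i}\ (1\le i\le b-1),$$ where the utilization factors are $$\rho_P=\frac{\alpha_{Pc}}{\mu_P+\sum_{i=1}^{b-1}\alpha^-_{Ps_i}},\qquad \rho_{Nc}=\frac{\alpha_{Nc}}{\mu_{Nc}},\qquad \rho_{Ns}=\frac{\sum_{i=1}^{b}\alpha^+_{Ns_i}}{\mu_{Ns}}.$$ Then, if $\rho_P\neq 1$, the transaction input rate per shard is $$\lambda=\frac{\rho_P(1-\rho_P^{\,b})}{1-\rho_P}\cdot\frac{\mu_P}{1+\frac{M-1}{M}},$$ and at the stability boundary $\rho_P=1$ of the consensus queue the rate $\lambda$ equals the maximum stable throughput per shard $$\lambda_{\max}=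\frac{b\,\mu_P}{1+\frac{M-1}{M}}.$$
   Context: The model is a symmetric queueing network of $M$ identical shards, each with a consensus queue $P$ (block production, service rate $\mu_P$) and a network queue $N$ (information dissemination; service rate $\mu_{Nc}$ for transactions and receipts, class $c$, and $\mu_{Ns}$ for block components, class $s$). A block contains at most $b$ transactions/receipts. $\lambda$ is the rate of newly issued transactions to each shard. $\alpha_{Pc},\alpha_{Nc}$ are the arrival rates of class $c$ customers to $P$ and $N$; $\alpha^-_{Ps_i}$ is the arrival rate of the negative signal $s_i^-$ to $P$; $\alpha^+_{Ns_i}$ is the arrival rate of the positive signal $s_i^+$ to $N$; $\rho_P,\rho_{Nc},\rho_{Ns}$ are the utilization factors. By symmetry, equations are written for a single shard. The network queue is assumed fast enough (both $\mu_{Nc}$ and $\mu_{Ns}$ much larger than $b\mu_P$) that the consensus queue is the bottleneck, so the maximum stable throughput per shard $\lambda_{\max}$ is by definition the value of $\lambda$ when $\rho_P=1$. *)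

theory Defs
  imports Complex_Main
begin

text \<open>
  Index conventions: \<open>an i\<close> is the arrival rate of the negative signal of index \<open>i\<close> at the
  consensus queue and is meaningful for \<open>1 \<le> i \<le> b - 1\<close>; \<open>ap i\<close> is the arrival rate of the
  positive signal of index \<open>i\<close> at the network queue and is meaningful for \<open>1 \<le> i \<le> b\<close>.
  Values of \<open>an\<close> and \<open>ap\<close> at other indices are unconstrained and are never used.
\<close>

definition traffic_equations ::
  "nat \<Rightarrow> nat \<Rightarrow> real \<Rightarrow> real \<Rightarrow> real \<Rightarrow> real \<Rightarrow> real \<Rightarrow> real \<Rightarrow>
   (nat \<Rightarrow> real) \<Rightarrow> (nat \<Rightarrow> real) \<Rightarrow> real \<Rightarrow> real \<Rightarrow> real \<Rightarrow> bool" where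
  "traffic_equations M b \<mu>_P \<mu>_Nc \<mu>_Ns l \<alpha>_Pc \<alpha>_Nc an ap \<rho>_P \<rho>_Nc \<rho>_Ns \<longleftrightarrow>
     \<alpha>_Pc = \<rho>_Nc * \<mu>_Nc \<and>
     (\<forall>i\<in>{1..b - 1}. an i = ap (i + 1)) \<and>
     \<alpha>_Nc = l + (real M - 1) * \<rho>_Ns * \<mu>_Ns * (1 / real M) * (l / \<alpha>_Nc) \<and>
     ap b = \<rho>_P * \<mu>_P \<and>
     (\<forall>i\<in>{1..b - 1}. ap i = \<rho>_P * an i) \<and>
     \<rho>_P = \<alpha>_Pc / (\<mu>_P + (\<Sum>i\<in>{1..b - 1}. an i)) \<and>
     \<rho>_Nc = \<alpha>_Nc / \<mu>_Nc \<and>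
     \<rho>_Ns = (\<Sum>i\<in>{1..b}. ap i) / \<mu>_Ns"

definition positive_rates ::
  "nat \<Rightarrow> real \<Rightarrow> real \<Rightarrow> real \<Rightarrow> (nat \<Rightarrow> real) \<Rightarrow> (nat \<Rightarrow> real) \<Rightarrow>
   real \<Rightarrow> real \<Rightarrow> real \<Rightarrow> bool" where
  "positive_rates b l \<alpha>_Pc \<alpha>_Nc an ap \<rho>_P \<rho>_Nc \<rho>_Ns \<longleftrightarrow>
     l > 0 \<and> \<alpha>_Pc > 0 \<and> \<alpha>_Nc > 0 \<and>
     (\<forall>i\<in>{1..b - 1}. an i > 0) \<and> (\<forall>i\<in>{1..b}. ap i > 0) \<and>
     \<rho>_P > 0 \<and> \<rho>_Nc > 0 \<and> \<rho>_Ns > 0"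

text \<open>
  The maximum stable throughput per shard is, by definition, the value of the input rate \<open>l\<close> for
  which the consensus queue is at its stability boundary, i.e. the utilization factor of the
  consensus queue (the argument \<open>1\<close> below) equals one.
\<close>

definition max_stable_throughput :: "nat \<Rightarrow> nat \<Rightarrow> real \<Rightarrow> real \<Rightarrow> real \<Rightarrow> real" where
  "max_stable_throughput M b \<mu>_P \<mu>_Nc \<mu>_Ns =
     (THE l. \<exists>\<alpha>_Pc \<alpha>_Nc an ap \<rho>_Nc \<rho>_Ns.
        positive_rates b l \<alpha>_Pc \<alpha>_Nc an ap 1 \<rho>_Nc \<rho>_Ns \<and>
        traffic_equations M b \<mu>_P \<mu>_Nc \<mu>_Ns l \<alpha>_Pc \<alpha>_Nc an ap 1 \<rho>_Nc \<rho>_Ns)"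

end

theory Submission
  imports Defs
begin

text \<open>
  The signal equations make the rates \<open>ap b, ap (b - 1), \<dots>, ap 1\<close> geometric with ratio \<open>\<rho>_P\<close>.
  Their sum \<open>S\<close> equals \<open>\<rho>_Ns * \<mu>_Ns\<close>, and it also equals \<open>\<alpha>_Nc\<close>, because
  \<open>\<alpha>_Pc = \<rho>_P * (\<mu>_P + \<Sum>i. an i)\<close>. Hence \<open>\<alpha>_Nc\<close> cancels in the nonlinear equation,
  which becomes \<open>S = l * (1 + (M - 1) / M)\<close>.
\<close>

text \<open>The recursion runs downward from index \<open>b\<close>, so induction is on the distance
  \<open>k\<close> from \<open>b\<close>. The exponent is \<open>Suc k\<close> because
  \<open>ap b\<close> already carries one factor \<rho>_P.\<close>

lemma positive_signal_rate:
  assumes "traffic_equations M b \<mu>_P \<mu>_Nc \<mu>_Ns l \<alpha>_Pc \<alpha>_Nc an ap \<rho>_P \<rho>_Nc \<rho>_Ns" and "k < b"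
  shows "ap (b - k) = \<mu>_P * \<rho>_P ^ Suc k"
  using assms(2)
proof (induction k)
  case 0
  then show ?case using assms(1) by (simp add: traffic_equations_def mult.commute)
next
  case (Suc k)
  \<comment> \<open>\<open>Suc k < b\<close> keeps the natural subtraction from truncating, so the
    index stays at least 1.\<close>
  then have mem: "b - Suc k \<in> {1..b - 1}" and step: "b - Suc k + 1 = b - k" by auto
  have "ap (b - Suc k) = \<rho>_P * an (b - Suc k)" "an (b - Suc k) = ap (b - Suc k + 1)"
    using assms(1) mem unfolding traffic_equations_def by blast+
  then show ?case using Suc step by (simp add: ac_simps)
qed

lemma sum_positive_signal_rates:
  assumes "traffic_equations M b \<mu>_P \<mu>_Nc \<mu>_Ns l \<alpha>_Pc \<alpha>_Nc an ap \<rho>_P \<rho>_Nc \<rho>_Ns"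
  shows "(\<Sum>i\<in>{1..b}. ap i) = \<mu>_P * (\<Sum>k<b. \<rho>_P ^ Suc k)"
proof -
  have "(\<Sum>i\<in>{1..b}. ap i) = (\<Sum>k<b. ap (b - k))"
    by (rule sum.reindex_bij_witness[of _ "\<lambda>k. b - k" "\<lambda>i. b - i"]) auto
  also have "\<dots> = (\<Sum>k<b. \<mu>_P * \<rho>_P ^ Suc k)"
    by (rule sum.cong) (use positive_signal_rate[OF assms] in auto)
  finally show ?thesis by (simp add: sum_distrib_left)
qed

lemma network_arrival_rate:
  assumes "b \<ge> 1" and "\<mu>_P > 0" and "\<mu>_Nc > 0"
    and pos: "positive_rates b l \<alpha>_Pc \<alpha>_Nc an ap \<rho>_P \<rho>_Nc \<rho>_Ns"
    and eqs: "traffic_equations M b \<mu>_P \<mu>_Nc \<mu>_Ns l \<alpha>_Pc \<alpha>_Nc an ap \<rho>_P \<rho>_Nc \<rho>_Ns"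
  shows "\<alpha>_Nc = (\<Sum>i\<in>{1..b}. ap i)"
proof -
  \<comment> \<open>Positivity allows clearing the denominator in the equation for \<rho>_P.\<close>
  have "\<mu>_P + (\<Sum>i\<in>{1..b - 1}. an i) > 0"
    using pos \<open>\<mu>_P > 0\<close> unfolding positive_rates_def
    by (intro add_pos_nonneg sum_nonneg) (auto intro: less_imp_le)
  then have "\<alpha>_Nc = \<rho>_P * (\<mu>_P + (\<Sum>i\<in>{1..b - 1}. an i))"
    using eqs \<open>\<mu>_Nc > 0\<close> by (simp add: traffic_equations_def)
  also have "\<dots> = ap b + (\<Sum>i\<in>{1..b - 1}. \<rho>_P * an i)"
    using eqs by (simp add: traffic_equations_def distrib_left sum_distrib_left)
  also have "(\<Sum>i\<in>{1..b - 1}. \<rho>_P * an i) = (\<Sum>i\<in>{1..b - 1}. ap i)"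
    using eqs by (intro sum.cong) (auto simp: traffic_equations_def)
  also have "ap b + (\<Sum>i\<in>{1..b - 1}. ap i) = (\<Sum>i\<in>{1..b}. ap i)"
    using \<open>b \<ge> 1\<close> by (cases b) auto
  finally show ?thesis .
qed

text \<open>The geometric sum is left unevaluated so that one formula covers both \<rho>_P = 1 and
  \<rho>_P \<noteq> 1. It also yields uniqueness of the boundary rate.\<close>

lemma input_rate_eq:
  assumes "M \<ge> 1" and "b \<ge> 1" and "\<mu>_P > 0" and "\<mu>_Nc > 0" and "\<mu>_Ns > 0"
    and pos: "positive_rates b l \<alpha>_Pc \<alpha>_Nc an ap \<rho>_P \<rho>_Nc \<rho>_Ns"
    and eqs: "traffic_equations M b \<mu>_P \<mu>_Nc \<mu>_Ns l \<alpha>_Pc \<alpha>_Nc an ap \<rho>_P \<rho>_Nc \<rho>_Ns"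
  shows "l = (\<Sum>k<b. \<rho>_P ^ Suc k) * (\<mu>_P / (1 + (real M - 1) / real M))"
proof -
  note S = network_arrival_rate[OF assms(2-4) pos eqs]
  have "\<alpha>_Nc > 0" using pos by (simp add: positive_rates_def)
  have "\<rho>_Ns * \<mu>_Ns = \<alpha>_Nc"
    using eqs \<open>\<mu>_Ns > 0\<close> S by (simp add: traffic_equations_def)
  moreover have "\<alpha>_Nc = l + (real M - 1) * \<rho>_Ns * \<mu>_Ns * (1 / real M) * (l / \<alpha>_Nc)"
    using eqs unfolding traffic_equations_def by blast
  \<comment> \<open>Regrouping exposes \<open>\<rho>_Ns * \<mu>_Ns\<close>; once replaced by
    \<alpha>_Nc, it cancels the denominator of \<open>l / \<alpha>_Nc\<close>.\<close>
  then have "\<alpha>_Nc = l + (real M - 1) * (\<rho>_Ns * \<mu>_Ns) * (1 / real M) * (l / \<alpha>_Nc)"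
    unfolding mult.assoc .
  ultimately have "\<alpha>_Nc = l * (1 + (real M - 1) / real M)"
    using \<open>\<alpha>_Nc > 0\<close> by (simp add: distrib_left mult.commute)
  moreover have "1 + (real M - 1) / real M > 0"
    using \<open>M \<ge> 1\<close> by (intro add_pos_nonneg) auto
  ultimately have "l = \<alpha>_Nc / (1 + (real M - 1) / real M)" by (simp add: eq_divide_eq)
  then show ?thesis
    using S sum_positive_signal_rates[OF eqs] by (simp add: mult.commute)
qed

text \<open>Existence half for the description operator \<open>THE\<close>. At \<rho>_P = 1 the
  geometric sequence is constant, so every signal rate is \<mu>_P and the \<open>b\<close> positive
  ones add up to \<open>b * \<mu>_P\<close>, which is then the arrival rate at both queues.\<close>

lemma boundary_solution:
  fixes M b :: nat and \<mu>_P \<mu>_Nc \<mu>_Ns :: real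
  assumes "M \<ge> 1" and "b \<ge> 1" and "\<mu>_P > 0" and "\<mu>_Nc > 0" and "\<mu>_Ns > 0"
  defines "l \<equiv> real b * \<mu>_P / (1 + (real M - 1) / real M)"
  shows "positive_rates b l (real b * \<mu>_P) (real b * \<mu>_P) (\<lambda>_. \<mu>_P) (\<lambda>_. \<mu>_P)
           1 (real b * \<mu>_P / \<mu>_Nc) (real b * \<mu>_P / \<mu>_Ns)"
    and "traffic_equations M b \<mu>_P \<mu>_Nc \<mu>_Ns l (real b * \<mu>_P) (real b * \<mu>_P)
           (\<lambda>_. \<mu>_P) (\<lambda>_. \<mu>_P) 1 (real b * \<mu>_P / \<mu>_Nc) (real b * \<mu>_P / \<mu>_Ns)"
proof -
  have d: "1 + (real M - 1) / real M > 0"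
    using \<open>M \<ge> 1\<close> by (intro add_pos_nonneg) auto
  show "positive_rates b l (real b * \<mu>_P) (real b * \<mu>_P) (\<lambda>_. \<mu>_P) (\<lambda>_. \<mu>_P)
           1 (real b * \<mu>_P / \<mu>_Nc) (real b * \<mu>_P / \<mu>_Ns)"
    using assms d by (auto simp: positive_rates_def)
  have "real b * \<mu>_P = l * (1 + (real M - 1) / real M)"
    using d by (simp add: l_def)
  also have "\<dots> = l + (real M - 1) * (real b * \<mu>_P / \<mu>_Ns) * \<mu>_Ns * (1 / real M)
                       * (l / (real b * \<mu>_P))"
    using assms(2,3,5) by (simp add: distrib_left)
  finally have arrival: "real b * \<mu>_P = \<dots>" .
  have "\<mu>_P + (\<Sum>i\<in>{1..b - 1}. \<mu>_P) = real b * \<mu>_P"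
    using \<open>b \<ge> 1\<close> by (simp add: of_nat_diff algebra_simps)
  then have utilization: "1 = real b * \<mu>_P / (\<mu>_P + (\<Sum>i\<in>{1..b - 1}. \<mu>_P))"
    using assms(2,3) by simp
  show "traffic_equations M b \<mu>_P \<mu>_Nc \<mu>_Ns l (real b * \<mu>_P) (real b * \<mu>_P)
           (\<lambda>_. \<mu>_P) (\<lambda>_. \<mu>_P) 1 (real b * \<mu>_P / \<mu>_Nc) (real b * \<mu>_P / \<mu>_Ns)"
    unfolding traffic_equations_def
    by (intro conjI arrival utilization) (use assms(4) in auto)
qed

lemma max_stable_throughput_eq:
  assumes "M \<ge> 1" and "b \<ge> 1" and "\<mu>_P > 0" and "\<mu>_Nc > 0" and "\<mu>_Ns > 0"
  shows "max_stable_throughput M b \<mu>_P \<mu>_Nc \<mu>_Ns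
           = real b * \<mu>_P / (1 + (real M - 1) / real M)"
  unfolding max_stable_throughput_def
proof (rule the_equality)
  show "\<exists>\<alpha>_Pc \<alpha>_Nc an ap \<rho>_Nc \<rho>_Ns.
      positive_rates b (real b * \<mu>_P / (1 + (real M - 1) / real M)) \<alpha>_Pc \<alpha>_Nc an ap 1 \<rho>_Nc \<rho>_Ns \<and>
      traffic_equations M b \<mu>_P \<mu>_Nc \<mu>_Ns (real b * \<mu>_P / (1 + (real M - 1) / real M))
        \<alpha>_Pc \<alpha>_Nc an ap 1 \<rho>_Nc \<rho>_Ns"
    using boundary_solution[OF assms] by blast
\<comment> \<open>Uniqueness: with utilization 1 every power is 1, so the sum in
  \<open>input_rate_eq\<close> is \<open>b\<close> and forces the rate.\<close>
qed (use input_rate_eq[OF assms] in fastforce)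

theorem mainTheorem1:
  fixes M b :: nat
    and \<mu>_P \<mu>_Nc \<mu>_Ns l \<alpha>_Pc \<alpha>_Nc \<rho>_P \<rho>_Nc \<rho>_Ns :: real
    and an ap :: "nat \<Rightarrow> real"
  assumes "M \<ge> 1" and "b \<ge> 1"
    and "\<mu>_P > 0" and "\<mu>_Nc > 0" and "\<mu>_Ns > 0"
    and "positive_rates b l \<alpha>_Pc \<alpha>_Nc an ap \<rho>_P \<rho>_Nc \<rho>_Ns"
    and "traffic_equations M b \<mu>_P \<mu>_Nc \<mu>_Ns l \<alpha>_Pc \<alpha>_Nc an ap \<rho>_P \<rho>_Nc \<rho>_Ns"
  shows "(\<rho>_P \<noteq> 1 \<longrightarrow>
            l = \<rho>_P * (1 - \<rho>_P ^ b) / (1 - \<rho>_P) * (\<mu>_P / (1 + (real M - 1) / real M))) \<and>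
         (\<rho>_P = 1 \<longrightarrow> l = max_stable_throughput M b \<mu>_P \<mu>_Nc \<mu>_Ns) \<and>
         max_stable_throughput M b \<mu>_P \<mu>_Nc \<mu>_Ns
            = real b * \<mu>_P / (1 + (real M - 1) / real M)"
proof -
  \<comment> \<open>Factoring out one \<rho>_P leaves the standard finite geometric sum, whose
    closed form requires \<rho>_P \<noteq> 1.\<close>
  have geom: "(\<Sum>k<b. \<rho>_P ^ Suc k) = \<rho>_P * (1 - \<rho>_P ^ b) / (1 - \<rho>_P)" if "\<rho>_P \<noteq> 1"
    using that by (simp add: sum_gp_strict flip: sum_distrib_left)
  show ?thesis
    using input_rate_eq[OF assms] max_stable_throughput_eq[OF assms(1-5)] geom by auto
qed

end
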